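(* Let $(\alpha,\beta)$ be a Bertrand curve pair in $\mathbb{R}^3$, $\beta=\alpha+\lambda N$, where $\alpha$ has Frenet frame $T,N,B$, curvature $\kappa$ and torsion $\tau$, and let $\theta$ be the angle with $T_\beta=\cos\theta\,T+\sin\theta\,B$. Then the following equations, representing the partner curve $\beta$ with respect to the normal connection $D^\perp$, hold: i) by means of the unit tangent $T$, $$\Big(\frac{1-\cos\theta}{\sin\theta}\kappa\Big)D^\perp_BD^\perp_BT-\Big(\frac{1-\cos\theta}{\sin\theta}\kappa'\Big)D^\perp_BT+\Big(\frac{1-\cos\theta}{\sin\theta}\kappa\Big)^3T=0;$$ ii) by means of the principal normal $N$, $$\Big(\frac{1-\cos\theta}{\sin\theta}\kappa\Big)D^\perp_BD^\perp_BN-\Big(\frac{1-\cos\theta}{\sin\theta}\kappa'\Big)D^\perp_BN+\Big(\frac{1-\cos\theta}{\sin\theta}\kappa\Big)^3N=0.$$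
   Context: Setting. $\alpha:I\to\mathbb{R}^3$ is a smooth unit speed curve with arc-length parameter $s$, Frenet frame $T,N,B$, curvature $\kappa>0$ and torsion $\tau>0$, with $T'=\kappa N$, $N'=-\kappa T+\tau B$, $B'=-\tau N$. A prime denotes $d/ds$. A Bertrand curve pair $(\alpha,\beta)$ consists of $\alpha$ and a curve $\beta$ having the same principal normal lines at corresponding points; then $\beta(s)=\alpha(s)+\lambda N(s)$ with $\lambda$ a real constant, and there is a real constant $\mu$ with $\lambda\kappa+\mu\tau=1$. It is assumed that $\lambda\neq0$ and $\mu\neq 0$. The unit tangent of $\beta$ is $T_\beta=\beta'/\|\beta'\|=\cos\theta\,T+\sin\theta\,B$, where $\theta$ is a constant angle with $\sin\theta\neq0$. The operators. On vector fields along $\alpha$, $D_B$ is the additive operator with $D_B(fX)=f'X+fD_BX$ for smooth functions $f$ of $s$, and $$D_BT=\frac{1-\cos\theta}{\sin\theta}\kappa N,\quad D_BN=-\frac{1-\cos\theta}{\sin\theta}\kappa T+\frac{1-\cos\theta}{\sin\theta}\tau B,\quad D_BB=-\frac{1-\cos\theta}{\sin\theta}\tau N.$$ The normal connection, acting on vector fields along $\alpha$ orthogonal to $B$, is $D^\perp_BX=D_BX-\langle D_BX,B\rangle B$. *)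

theory Defs
  imports "HOL-Analysis.Analysis"
begin

text \<open>
  Curves, vector fields along them and scalar functions on the parameter interval I are total
  functions on the reals of which only the values on I matter. Derivatives are taken within I, so
  that they are one-sided at an end point that belongs to I.
\<close>

definition vderiv :: "real set \<Rightarrow> (real \<Rightarrow> 'a) \<Rightarrow> real \<Rightarrow> 'a::real_normed_vector" where
  "vderiv I f = (\<lambda>s. vector_derivative f (at s within I))"

definition smooth_on :: "real set \<Rightarrow> (real \<Rightarrow> 'a::real_normed_vector) \<Rightarrow> bool" where
  "smooth_on I f \<longleftrightarrow> (\<forall>k. \<forall>s\<in>I. (vderiv I ^^ k) f differentiable (at s within I))"

text \<open>
  The Frenet apparatus of a regular curve in an arbitrary parametrisation: the partner of a unit
  speed curve in a Bertrand pair need not itself have unit speed. The torsion has the sign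
  for which B' = - tau N in arc length.
\<close>

definition tangent :: "real set \<Rightarrow> (real \<Rightarrow> real^3) \<Rightarrow> real \<Rightarrow> real^3" where
  "tangent I \<gamma> s = vderiv I \<gamma> s /\<^sub>R norm (vderiv I \<gamma> s)"

definition normal :: "real set \<Rightarrow> (real \<Rightarrow> real^3) \<Rightarrow> real \<Rightarrow> real^3" where
  "normal I \<gamma> s = vderiv I (tangent I \<gamma>) s /\<^sub>R norm (vderiv I (tangent I \<gamma>) s)"

definition binormal :: "real set \<Rightarrow> (real \<Rightarrow> real^3) \<Rightarrow> real \<Rightarrow> real^3" where
  "binormal I \<gamma> s = cross3 (tangent I \<gamma> s) (normal I \<gamma> s)"

definition curvature :: "real set \<Rightarrow> (real \<Rightarrow> real^3) \<Rightarrow> real \<Rightarrow> real" where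
  "curvature I \<gamma> s = norm (vderiv I (tangent I \<gamma>) s) / norm (vderiv I \<gamma> s)"

definition torsion :: "real set \<Rightarrow> (real \<Rightarrow> real^3) \<Rightarrow> real \<Rightarrow> real" where
  "torsion I \<gamma> s = (vderiv I (normal I \<gamma>) s \<bullet> binormal I \<gamma> s) / norm (vderiv I \<gamma> s)"

definition frenet_curve :: "real set \<Rightarrow> (real \<Rightarrow> real^3) \<Rightarrow> bool" where
  "frenet_curve I \<gamma> \<longleftrightarrow>
     smooth_on I \<gamma> \<and> (\<forall>s\<in>I. vderiv I \<gamma> s \<noteq> 0 \<and> curvature I \<gamma> s > 0)"

definition unit_speed :: "real set \<Rightarrow> (real \<Rightarrow> real^3) \<Rightarrow> bool" where
  "unit_speed I \<gamma> \<longleftrightarrow> (\<forall>s\<in>I. norm (vderiv I \<gamma> s) = 1)"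

definition normal_line :: "real set \<Rightarrow> (real \<Rightarrow> real^3) \<Rightarrow> real \<Rightarrow> (real^3) set" where
  "normal_line I \<gamma> s = {\<gamma> s + t *\<^sub>R normal I \<gamma> s | t. True}"

definition bertrand_pair :: "real set \<Rightarrow> (real \<Rightarrow> real^3) \<Rightarrow> (real \<Rightarrow> real^3) \<Rightarrow> bool" where
  "bertrand_pair I \<alpha> \<beta> \<longleftrightarrow>
     frenet_curve I \<alpha> \<and> frenet_curve I \<beta> \<and>
     (\<forall>s\<in>I. normal_line I \<alpha> s = normal_line I \<beta> s)"

text \<open>
  D is the operator D_B on the smooth vector fields along the curve. The first two conditions say
  that D is a well-defined operation on smooth fields over I; the congruence condition is needed
  because fields are represented by total functions.
\<close>

definition is_D_B ::
  "real set \<Rightarrow> (real \<Rightarrow> real^3) \<Rightarrow> real \<Rightarrow> ((real \<Rightarrow> real^3) \<Rightarrow> (real \<Rightarrow> real^3)) \<Rightarrow> bool" where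
  "is_D_B I \<alpha> \<theta> D \<longleftrightarrow>
     (let T = tangent I \<alpha>; N = normal I \<alpha>; B = binormal I \<alpha>;
          \<kappa> = curvature I \<alpha>; \<tau> = torsion I \<alpha>; c = (1 - cos \<theta>) / sin \<theta>
      in
        (\<forall>X. smooth_on I X \<longrightarrow> smooth_on I (D X)) \<and>
        (\<forall>X Y. smooth_on I X \<longrightarrow> smooth_on I Y \<longrightarrow> (\<forall>s\<in>I. X s = Y s) \<longrightarrow>
           (\<forall>s\<in>I. D X s = D Y s)) \<and>
        (\<forall>X Y. smooth_on I X \<longrightarrow> smooth_on I Y \<longrightarrow>
           (\<forall>s\<in>I. D (\<lambda>u. X u + Y u) s = D X s + D Y s)) \<and>
        (\<forall>(f :: real \<Rightarrow> real) X. smooth_on I f \<longrightarrow> smooth_on I X \<longrightarrow>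
           (\<forall>s\<in>I. D (\<lambda>u. f u *\<^sub>R X u) s = vderiv I f s *\<^sub>R X s + f s *\<^sub>R D X s)) \<and>
        (\<forall>s\<in>I. D T s = (c * \<kappa> s) *\<^sub>R N s) \<and>
        (\<forall>s\<in>I. D N s = - (c * \<kappa> s) *\<^sub>R T s + (c * \<tau> s) *\<^sub>R B s) \<and>
        (\<forall>s\<in>I. D B s = - (c * \<tau> s) *\<^sub>R N s))"

text \<open>
  The geometric meaning of the normal connection is restricted to fields X orthogonal to the
  binormal; on other fields the formula is just a convenient total extension.
\<close>

definition normal_connection ::
  "real set \<Rightarrow> (real \<Rightarrow> real^3) \<Rightarrow> ((real \<Rightarrow> real^3) \<Rightarrow> (real \<Rightarrow> real^3)) \<Rightarrow>
     (real \<Rightarrow> real^3) \<Rightarrow> (real \<Rightarrow> real^3)" where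
  "normal_connection I \<alpha> D X =
     (\<lambda>s. D X s - (D X s \<bullet> binormal I \<alpha> s) *\<^sub>R binormal I \<alpha> s)"

end

theory Submission imports Defs begin

text \<open>
  The normal connection discards the B-component, so that on the span of T and N it acts by
  T \<mapsto> c\<kappa> N and N \<mapsto> - c\<kappa> T. Applying it twice with the Leibniz rule gives both
  equations. The analytic content is that the fields and coefficients are smooth, so that the
  Leibniz rule for D applies: T is the derivative of the unit speed curve, while \<kappa> and N are
  T' \<bullet> T' to the power 1/2, and T' scaled by T' \<bullet> T' to the power -1/2.
\<close>

section \<open>Differentiability of finite order within a set\<close>

definition times_diff_on :: "nat \<Rightarrow> real set \<Rightarrow> (real \<Rightarrow> 'a::real_normed_vector) \<Rightarrow> bool" where
  "times_diff_on n I f \<longleftrightarrow> (\<forall>k<n. \<forall>s\<in>I. (vderiv I ^^ k) f differentiable (at s within I))"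

text \<open>Smoothness offers nothing to induct on, so closure properties are proved for each finite
  order \<open>n\<close> by induction and transferred through this equivalence.\<close>

lemma smooth_on_iff_times_diff_on: "smooth_on I f \<longleftrightarrow> (\<forall>n. times_diff_on n I f)"
  unfolding smooth_on_def times_diff_on_def using lessI by blast

lemma times_diff_on_0 [simp]: "times_diff_on 0 I f"
  by (simp add: times_diff_on_def)

text \<open>The recursion peels off the first derivative, not the last, so that inductions on
  \<open>n\<close> can pass from \<open>f\<close> to \<open>vderiv I f\<close>.\<close>

lemma times_diff_on_Suc:
  "times_diff_on (Suc n) I f \<longleftrightarrow>
     (\<forall>s\<in>I. f differentiable (at s within I)) \<and> times_diff_on n I (vderiv I f)"
  unfolding times_diff_on_def by (simp add: All_less_Suc2 funpow_Suc_right del: funpow.simps)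

lemma times_diff_on_mono: "times_diff_on n I f \<Longrightarrow> m \<le> n \<Longrightarrow> times_diff_on m I f"
  unfolding times_diff_on_def by auto

lemma has_vector_derivative_vderiv:
  "f differentiable (at s within I) \<Longrightarrow> (f has_vector_derivative vderiv I f s) (at s within I)"
  unfolding vderiv_def by (simp add: vector_derivative_works)

text \<open>The filter \<open>at s within I\<close> does not see the point \<open>s\<close>; the
  hypothesis \<open>s \<in> I\<close> supplies agreement there.\<close>

lemma has_vector_derivative_cong_on:
  assumes "\<And>u. u \<in> I \<Longrightarrow> f u = g u" "s \<in> I"
  shows "(f has_vector_derivative d) (at s within I) \<longleftrightarrow> (g has_vector_derivative d) (at s within I)"
  using assms by (intro has_vector_derivative_cong_ev) (auto simp: eventually_at_filter)

lemma vderiv_cong: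
  assumes "\<And>u. u \<in> I \<Longrightarrow> f u = g u" "s \<in> I"
  shows "vderiv I f s = vderiv I g s"
  using has_vector_derivative_cong_on[OF assms] unfolding vderiv_def vector_derivative_def by simp

lemma times_diff_on_cong:
  assumes "\<And>u. u \<in> I \<Longrightarrow> f u = g u" "times_diff_on n I f"
  shows "times_diff_on n I g"
  using assms
proof (induction n arbitrary: f g)
  case (Suc n)
  have "g differentiable (at s within I)" if "s \<in> I" for s
  proof -
    have "(f has_vector_derivative vderiv I f s) (at s within I)"
      using Suc.prems that by (simp add: times_diff_on_Suc has_vector_derivative_vderiv)
    then have "(g has_vector_derivative vderiv I f s) (at s within I)"
      using has_vector_derivative_cong_on[of I f g s] Suc.prems(1) that by blast
    then show ?thesis
      by (rule differentiableI_vector)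
  qed
  moreover have "times_diff_on n I (vderiv I g)"
  proof (rule Suc.IH)
    show "vderiv I f u = vderiv I g u" if "u \<in> I" for u
      using Suc.prems(1) that by (rule vderiv_cong)
    show "times_diff_on n I (vderiv I f)"
      using Suc.prems(2) by (simp add: times_diff_on_Suc)
  qed
  ultimately show ?case
    by (simp add: times_diff_on_Suc)
qed simp

lemma smooth_on_cong:
  "smooth_on I f \<Longrightarrow> (\<And>u. u \<in> I \<Longrightarrow> f u = g u) \<Longrightarrow> smooth_on I g"
  unfolding smooth_on_iff_times_diff_on by (metis times_diff_on_cong)

lemma smooth_on_has_vector_derivative:
  "smooth_on I f \<Longrightarrow> s \<in> I \<Longrightarrow> (f has_vector_derivative vderiv I f s) (at s within I)"
  using has_vector_derivative_vderiv[of f s I] unfolding smooth_on_def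
  by (auto dest: spec[of _ 0])

lemma smooth_on_vderiv: "smooth_on I f \<Longrightarrow> smooth_on I (vderiv I f)"
  unfolding smooth_on_iff_times_diff_on by (metis times_diff_on_Suc)

section \<open>Calculus of smooth functions on a set without isolated points\<close>

context
  fixes I :: "real set"
  assumes at_within_neq_bot: "\<And>s. s \<in> I \<Longrightarrow> at s within I \<noteq> bot"
begin

text \<open>Derivatives within \<open>I\<close> are unique at limit points of \<open>I\<close>,
  which is what the context assumption provides.\<close>

lemma vderiv_eqI:
  "(f has_vector_derivative d) (at s within I) \<Longrightarrow> s \<in> I \<Longrightarrow> vderiv I f s = d"
  unfolding vderiv_def by (rule vector_derivative_within[OF at_within_neq_bot])

lemma times_diff_on_SucI:
  assumes "\<And>s. s \<in> I \<Longrightarrow> (f has_vector_derivative f' s) (at s within I)" "times_diff_on n I f'"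
  shows "times_diff_on (Suc n) I f"
  unfolding times_diff_on_Suc
proof
  show "\<forall>s\<in>I. f differentiable (at s within I)"
    using assms(1) differentiableI_vector by blast
  show "times_diff_on n I (vderiv I f)"
    by (rule times_diff_on_cong[OF _ assms(2)]) (simp add: vderiv_eqI[OF assms(1)])
qed

lemma times_diff_on_const: "times_diff_on n I (\<lambda>s. a)"
proof (induction n arbitrary: a)
  case (Suc n)
  show ?case
    by (rule times_diff_on_SucI[of _ "\<lambda>s. 0"]) (auto intro: Suc.IH)
qed simp

lemma times_diff_on_add:
  "times_diff_on n I f \<Longrightarrow> times_diff_on n I g \<Longrightarrow> times_diff_on n I (\<lambda>s. f s + g s)"
proof (induction n arbitrary: f g)
  case (Suc n)
  show ?case
    by (rule times_diff_on_SucI[of _ "\<lambda>s. vderiv I f s + vderiv I g s"])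
      (use Suc in \<open>auto simp: times_diff_on_Suc
        intro!: has_vector_derivative_add has_vector_derivative_vderiv\<close>)
qed simp

lemma times_diff_on_bilinear:
  assumes "bounded_bilinear p"
  shows "times_diff_on n I f \<Longrightarrow> times_diff_on n I g \<Longrightarrow> times_diff_on n I (\<lambda>s. p (f s) (g s))"
proof (induction n arbitrary: f g)
  case (Suc n)
  have "times_diff_on n I f" "times_diff_on n I g"
    using Suc.prems by (auto elim: times_diff_on_mono)
  \<comment> \<open>The product rule leaves the pairs \<open>f\<close>, \<open>g'\<close> and
    \<open>f'\<close>, \<open>g\<close>, each of order \<open>n\<close>; hence the induction over
    arbitrary \<open>f\<close> and \<open>g\<close>.\<close>
  then have "times_diff_on n I (\<lambda>s. p (f s) (vderiv I g s) + p (vderiv I f s) (g s))"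
    using Suc by (intro times_diff_on_add Suc.IH) (simp_all add: times_diff_on_Suc)
  then show ?case
    using Suc.prems
    by (intro times_diff_on_SucI[of "\<lambda>s. p (f s) (g s)"])
      (auto simp: times_diff_on_Suc
        intro: bounded_bilinear.has_vector_derivative[OF assms] has_vector_derivative_vderiv)
qed simp

text \<open>The derivative of \<open>f powr r\<close> contains \<open>f powr (r - 1)\<close>, so the
  induction keeps \<open>r\<close> arbitrary. Positivity stays available because the base never
  changes.\<close>

lemma times_diff_on_powr:
  fixes f :: "real \<Rightarrow> real"
  assumes pos: "\<And>s. s \<in> I \<Longrightarrow> f s > 0"
  shows "times_diff_on n I f \<Longrightarrow> times_diff_on n I (\<lambda>s. f s powr r)"
proof (induction n arbitrary: r)
  case (Suc n)
  have "times_diff_on n I f"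
    using Suc.prems by (rule times_diff_on_mono) simp
  then have "times_diff_on n I (\<lambda>s. r * f s powr (r - 1) * vderiv I f s)"
    using Suc by (intro times_diff_on_bilinear[OF bounded_bilinear_mult] times_diff_on_const)
      (simp_all add: times_diff_on_Suc)
  moreover have "((\<lambda>s. f s powr r) has_vector_derivative r * f s powr (r - 1) * vderiv I f s)
      (at s within I)" if "s \<in> I" for s
  proof -
    have "(f has_real_derivative vderiv I f s) (at s within I)"
      unfolding has_real_derivative_iff_has_vector_derivative
      using Suc.prems that by (simp add: times_diff_on_Suc has_vector_derivative_vderiv)
    then show ?thesis
      unfolding has_real_derivative_iff_has_vector_derivative[symmetric]
      using pos[OF that]
      by (auto intro: DERIV_chain2[where f = "\<lambda>z. z powr r" and g = f] has_real_derivative_powr)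
  qed
  ultimately show ?case
    by (intro times_diff_on_SucI)
qed simp

lemma smooth_on_const: "smooth_on I (\<lambda>s. a)"
  unfolding smooth_on_iff_times_diff_on using times_diff_on_const by blast

lemma smooth_on_bilinear:
  "bounded_bilinear p \<Longrightarrow> smooth_on I f \<Longrightarrow> smooth_on I g \<Longrightarrow> smooth_on I (\<lambda>s. p (f s) (g s))"
  unfolding smooth_on_iff_times_diff_on using times_diff_on_bilinear by blast

lemmas smooth_on_mult = smooth_on_bilinear[OF bounded_bilinear_mult]
  and smooth_on_scaleR = smooth_on_bilinear[OF bounded_bilinear_scaleR]
  and smooth_on_inner = smooth_on_bilinear[OF bounded_bilinear_inner]

lemma smooth_on_powr:
  fixes f :: "real \<Rightarrow> real"
  shows "smooth_on I f \<Longrightarrow> (\<And>s. s \<in> I \<Longrightarrow> f s > 0) \<Longrightarrow> smooth_on I (\<lambda>s. f s powr r)"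
  unfolding smooth_on_iff_times_diff_on using times_diff_on_powr by blast

text \<open>The norm is handled through its square \<open>f s \<bullet> f s\<close>, which is smooth
  as a bilinear expression and positive where \<open>f\<close> does not vanish; halving the exponent
  compensates.\<close>

lemma smooth_on_norm_powr:
  fixes f :: "real \<Rightarrow> 'a::real_inner"
  assumes "smooth_on I f" "\<And>s. s \<in> I \<Longrightarrow> f s \<noteq> 0"
  shows "smooth_on I (\<lambda>s. norm (f s) powr r)"
proof (rule smooth_on_cong)
  show "smooth_on I (\<lambda>s. (f s \<bullet> f s) powr (r / 2))"
    using assms by (intro smooth_on_powr smooth_on_inner) auto
  show "(f s \<bullet> f s) powr (r / 2) = norm (f s) powr r" for s
  proof -
    have "f s \<bullet> f s = norm (f s) powr 2"
      by (simp add: power2_norm_eq_inner)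
    then show ?thesis
      by (simp only: powr_powr) simp
  qed
qed

lemma vderiv_const_mult:
  fixes a :: real
  assumes "smooth_on I f" "s \<in> I"
  shows "vderiv I (\<lambda>u. a * f u) s = a * vderiv I f s"
  using smooth_on_has_vector_derivative[OF assms] assms(2)
  by (intro vderiv_eqI) (auto intro!: derivative_eq_intros)

text \<open>Differentiate \<open>f u \<bullet> f u\<close>, which is constantly
  \<open>a\<^sup>2\<close> on \<open>I\<close>: the product rule gives twice the inner product in
  question.\<close>

lemma inner_vderiv_eq_0:
  fixes f :: "real \<Rightarrow> 'a::real_inner"
  assumes "smooth_on I f" "\<And>u. u \<in> I \<Longrightarrow> norm (f u) = a" "s \<in> I"
  shows "f s \<bullet> vderiv I f s = 0"
proof -
  have "((\<lambda>u. f u \<bullet> f u) has_vector_derivative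
      f s \<bullet> vderiv I f s + vderiv I f s \<bullet> f s) (at s within I)"
    using assms smooth_on_has_vector_derivative
    by (intro bounded_bilinear.has_vector_derivative[OF bounded_bilinear_inner]) blast+
  then have "((\<lambda>u. a\<^sup>2) has_vector_derivative 2 * (f s \<bullet> vderiv I f s)) (at s within I)"
    by (subst has_vector_derivative_cong_on[of I _ "\<lambda>u. f u \<bullet> f u"])
      (use assms in \<open>auto simp: inner_commute power2_norm_eq_inner[symmetric]\<close>)
  then have "vderiv I (\<lambda>u. a\<^sup>2) s = 2 * (f s \<bullet> vderiv I f s)"
    using assms(3) by (rule vderiv_eqI)
  moreover have "vderiv I (\<lambda>u. a\<^sup>2) s = 0"
    using assms(3) by (intro vderiv_eqI) auto
  ultimately show ?thesis by simp
qed

section \<open>The Frenet frame of a unit speed curve\<close>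

context
  fixes \<alpha> :: "real \<Rightarrow> real^3"
  assumes frenet: "frenet_curve I \<alpha>" and unit: "unit_speed I \<alpha>"
begin

lemma norm_vderiv_curve: "s \<in> I \<Longrightarrow> norm (vderiv I \<alpha> s) = 1"
  using unit by (simp add: unit_speed_def)

lemma norm_tangent: "s \<in> I \<Longrightarrow> norm (tangent I \<alpha> s) = 1"
  by (simp add: tangent_def norm_vderiv_curve)

lemma smooth_on_tangent: "smooth_on I (tangent I \<alpha>)"
proof (rule smooth_on_cong)
  show "smooth_on I (vderiv I \<alpha>)"
    using frenet by (simp add: frenet_curve_def smooth_on_vderiv)
  show "vderiv I \<alpha> s = tangent I \<alpha> s" if "s \<in> I" for s
    using that by (simp add: tangent_def norm_vderiv_curve)
qed

lemma curvature_eq: "s \<in> I \<Longrightarrow> curvature I \<alpha> s = norm (vderiv I (tangent I \<alpha>) s)"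
  by (simp add: curvature_def norm_vderiv_curve)

lemma vderiv_tangent_nonzero: "s \<in> I \<Longrightarrow> vderiv I (tangent I \<alpha>) s \<noteq> 0"
  using frenet curvature_eq by (fastforce simp: frenet_curve_def)

lemma smooth_on_curvature: "smooth_on I (curvature I \<alpha>)"
proof (rule smooth_on_cong)
  show "smooth_on I (\<lambda>s. norm (vderiv I (tangent I \<alpha>) s) powr 1)"
    by (intro smooth_on_norm_powr smooth_on_vderiv smooth_on_tangent vderiv_tangent_nonzero)
qed (simp add: curvature_eq)

lemma smooth_on_normal: "smooth_on I (normal I \<alpha>)"
proof (rule smooth_on_cong)
  show "smooth_on I (\<lambda>s. norm (vderiv I (tangent I \<alpha>) s) powr - 1 *\<^sub>R vderiv I (tangent I \<alpha>) s)"
    by (intro smooth_on_scaleR smooth_on_norm_powr smooth_on_vderiv smooth_on_tangent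
        vderiv_tangent_nonzero)
qed (simp add: normal_def powr_minus)

lemma norm_normal: "s \<in> I \<Longrightarrow> norm (normal I \<alpha> s) = 1"
  by (simp add: normal_def vderiv_tangent_nonzero)

text \<open>The tangent has constant norm, hence is orthogonal to its derivative, of which the
  normal is a multiple.\<close>

lemma tangent_inner_normal: "s \<in> I \<Longrightarrow> tangent I \<alpha> s \<bullet> normal I \<alpha> s = 0"
  using inner_vderiv_eq_0[OF smooth_on_tangent norm_tangent] by (simp add: normal_def)

text \<open>Lagrange's identity for the norm of a cross product, applied to two orthogonal unit
  vectors.\<close>

lemma binormal_inner_self: "s \<in> I \<Longrightarrow> binormal I \<alpha> s \<bullet> binormal I \<alpha> s = 1"
  using norm_cross[of "tangent I \<alpha> s" "normal I \<alpha> s"]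
  by (simp add: binormal_def power2_norm_eq_inner[symmetric] norm_tangent norm_normal
      tangent_inner_normal)

lemma tangent_inner_binormal: "tangent I \<alpha> s \<bullet> binormal I \<alpha> s = 0"
  and normal_inner_binormal: "normal I \<alpha> s \<bullet> binormal I \<alpha> s = 0"
  by (simp_all add: binormal_def dot_cross_self)

section \<open>The normal connection on multiples of tangent and normal\<close>

context
  fixes \<theta> c :: real and D Dperp :: "(real \<Rightarrow> real^3) \<Rightarrow> (real \<Rightarrow> real^3)"
  assumes D: "is_D_B I \<alpha> \<theta> D"
  defines "c \<equiv> (1 - cos \<theta>) / sin \<theta>"
    and "Dperp \<equiv> normal_connection I \<alpha> D"
begin

lemma Dperp_tangent: "s \<in> I \<Longrightarrow> Dperp (tangent I \<alpha>) s = (c * curvature I \<alpha> s) *\<^sub>R normal I \<alpha> s"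
  using D by (simp add: Dperp_def normal_connection_def is_D_B_def Let_def c_def
      normal_inner_binormal)

text \<open>The torsion term of \<open>D N\<close> is a multiple of the unit vector
  \<open>B\<close>, so the projection removes exactly it.\<close>

lemma Dperp_normal: "s \<in> I \<Longrightarrow> Dperp (normal I \<alpha>) s = - (c * curvature I \<alpha> s) *\<^sub>R tangent I \<alpha> s"
  using D by (simp add: Dperp_def normal_connection_def is_D_B_def Let_def c_def
      tangent_inner_binormal binormal_inner_self inner_diff_left)

text \<open>Leibniz rule for \<open>Dperp\<close>: the term with \<open>vderiv I f s\<close> is
  orthogonal to the binormal, so the projection changes only the other one. \<open>Y\<close> is
  compared with the multiple on \<open>I\<close> alone because \<open>Dperp\<close> of a frame field
  is known only there.\<close>

lemma Dperp_of_multiple: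
  assumes f: "smooth_on I f" and X: "smooth_on I X" and Y: "\<And>u. u \<in> I \<Longrightarrow> Y u = f u *\<^sub>R X u"
    and orth: "X s \<bullet> binormal I \<alpha> s = 0" and s: "s \<in> I"
  shows "Dperp Y s = vderiv I f s *\<^sub>R X s + f s *\<^sub>R Dperp X s"
proof -
  have fX: "smooth_on I (\<lambda>u. f u *\<^sub>R X u)"
    using f X by (rule smooth_on_scaleR)
  moreover have "smooth_on I Y"
    using fX Y by (auto intro: smooth_on_cong)
  ultimately have "D Y s = D (\<lambda>u. f u *\<^sub>R X u) s"
    using D s Y unfolding is_D_B_def Let_def by blast
  also have "\<dots> = vderiv I f s *\<^sub>R X s + f s *\<^sub>R D X s"
    using D f X s unfolding is_D_B_def Let_def by blast
  finally show ?thesis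
    using orth by (simp add: Dperp_def normal_connection_def inner_add_left algebra_simps)
qed

text \<open>Leibniz rule with coefficient \<open>c * \<kappa>\<close> and field \<open>N\<close>;
  the second \<open>Dperp\<close> turns \<open>N\<close> back into a multiple of
  \<open>T\<close>.\<close>

lemma Dperp_Dperp_tangent:
  assumes "s \<in> I"
  shows "Dperp (Dperp (tangent I \<alpha>)) s =
    (c * vderiv I (curvature I \<alpha>) s) *\<^sub>R normal I \<alpha> s - (c * curvature I \<alpha> s)\<^sup>2 *\<^sub>R tangent I \<alpha> s"
  using Dperp_of_multiple[OF smooth_on_mult[OF smooth_on_const smooth_on_curvature]
      smooth_on_normal Dperp_tangent normal_inner_binormal assms]
  by (simp add: assms Dperp_normal vderiv_const_mult smooth_on_curvature power2_eq_square)

lemma Dperp_Dperp_normal: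
  assumes "s \<in> I"
  shows "Dperp (Dperp (normal I \<alpha>)) s =
    - (c * vderiv I (curvature I \<alpha>) s) *\<^sub>R tangent I \<alpha> s - (c * curvature I \<alpha> s)\<^sup>2 *\<^sub>R normal I \<alpha> s"
proof -
  \<comment> \<open>The sign moves into the constant, so that the coefficient is again a constant
    times the curvature.\<close>
  have "Dperp (normal I \<alpha>) u = (- c * curvature I \<alpha> u) *\<^sub>R tangent I \<alpha> u" if "u \<in> I" for u
    using Dperp_normal[OF that] by simp
  from Dperp_of_multiple[OF smooth_on_mult[OF smooth_on_const smooth_on_curvature]
      smooth_on_tangent this tangent_inner_binormal assms]
  show ?thesis
    by (simp add: assms Dperp_tangent vderiv_const_mult[of _ _ "- c", simplified]
        smooth_on_curvature power2_eq_square)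
qed

end

end

end

theorem theorem2p6:
  fixes I :: "real set"
    and \<alpha> \<beta> :: "real \<Rightarrow> real^3"
    and T N B :: "real \<Rightarrow> real^3"
    and \<kappa> \<tau> :: "real \<Rightarrow> real"
    and lam \<mu> \<theta> c :: real
    and D Dperp :: "(real \<Rightarrow> real^3) \<Rightarrow> (real \<Rightarrow> real^3)"
  defines "T \<equiv> tangent I \<alpha>"
    and "N \<equiv> normal I \<alpha>"
    and "B \<equiv> binormal I \<alpha>"
    and "\<kappa> \<equiv> curvature I \<alpha>"
    and "\<tau> \<equiv> torsion I \<alpha>"
    and "c \<equiv> (1 - cos \<theta>) / sin \<theta>"
    and "Dperp \<equiv> normal_connection I \<alpha> D"
  assumes "is_interval I" and "interior I \<noteq> {}"
    and "unit_speed I \<alpha>"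
    and "\<forall>s\<in>I. \<kappa> s > 0" and "\<forall>s\<in>I. \<tau> s > 0"
    and "bertrand_pair I \<alpha> \<beta>"
    and "\<forall>s\<in>I. \<beta> s = \<alpha> s + lam *\<^sub>R N s" and "lam \<noteq> 0"
    and "\<forall>s\<in>I. lam * \<kappa> s + \<mu> * \<tau> s = 1" and "\<mu> \<noteq> 0"
    and "\<forall>s\<in>I. tangent I \<beta> s = cos \<theta> *\<^sub>R T s + sin \<theta> *\<^sub>R B s" and "sin \<theta> \<noteq> 0"
    and "is_D_B I \<alpha> \<theta> D"
  shows "(\<forall>s\<in>I. (c * \<kappa> s) *\<^sub>R Dperp (Dperp T) s - (c * vderiv I \<kappa> s) *\<^sub>R Dperp T s
             + (c * \<kappa> s) ^ 3 *\<^sub>R T s = 0) \<and>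
         (\<forall>s\<in>I. (c * \<kappa> s) *\<^sub>R Dperp (Dperp N) s - (c * vderiv I \<kappa> s) *\<^sub>R Dperp N s
             + (c * \<kappa> s) ^ 3 *\<^sub>R N s = 0)"
proof -
  \<comment> \<open>A connected set that is not a singleton has no isolated points, so derivatives
    within the interval are unique, end points included.\<close>
  have "I \<noteq> {x}" for x
    using \<open>interior I \<noteq> {}\<close> by auto
  then have nb: "at s within I \<noteq> bot" if "s \<in> I" for s
    using connected_imp_perfect[of I s] \<open>is_interval I\<close> that
    by (simp add: is_interval_connected trivial_limit_within)
  have frenet: "frenet_curve I \<alpha>"
    using \<open>bertrand_pair I \<alpha> \<beta>\<close> by (simp add: bertrand_pair_def)
  note context_facts = nb frenet \<open>unit_speed I \<alpha>\<close> \<open>is_D_B I \<alpha> \<theta> D\<close>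
  \<comment> \<open>After substitution, the terms with the derivative of \<open>\<kappa>\<close>
    cancel in pairs, and the squared coefficient times \<open>c * \<kappa>\<close> cancels the
    cube.\<close>
  show ?thesis
    unfolding T_def N_def \<kappa>_def c_def Dperp_def
    by (simp add: Dperp_Dperp_tangent[OF context_facts] Dperp_Dperp_normal[OF context_facts]
        Dperp_tangent[OF context_facts] Dperp_normal[OF context_facts]
        algebra_simps power2_eq_square power3_eq_cube)
qed

end
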